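(* For every integer $n \ge 2$ and every $x \in \mathbb{R}$, $$ \begin{aligned} g_n(x) ={}& \sum_{k=0}^{n-2} \sum_{r=0}^{k} \sum_{t=0}^{n-k} (-1)^r\binom{n-1}{k}\binom{k}{r}\,\frac{n-k}{2}\,\frac{(-1)^{n-k-t}}{t!\,(n-k-t)!}\left(x+k-r-\frac{n}{2}+t\right)^{n-k-2}\left|x+k-r-\frac{n}{2}+t\right| \\ &+ \sum_{r=0}^{n-1} (-1)^r\binom{n-1}{r}\, g_1\!\left(x+\frac{n-1}{2}-r\right). \end{aligned} $$
   Context: $\mathbb{N}=\{1,2,3,\dots\}$. The functions $g_n:\mathbb{R}\to\mathbb{R}$ are defined recursively by $g_1(x)=\chi_{(-1/2,1/2)}(x)$, the characteristic function of the open interval $(-1/2,1/2)$ (equal to $1$ on $(-1/2,1/2)$ and $0$ elsewhere in $\mathbb{R}$, in particular $g_1(\pm 1/2)=0$), and $$g_{n+1}(x)=g_n(x+1/2)-g_n(x-1/2)+\int_{x-\frac12}^{x+\frac12} g_n(s)\,ds,\qquad n\in\mathbb{N},\ x\in\mathbb{R}.$$ When the exponent $n-k-2$ is $0$, the corresponding power is read as $1$. *)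

theory Defs
  imports "HOL-Analysis.Analysis"
begin

text \<open>The sequence is indexed from 1; the value at index 0 is a dummy.  The integral over the
  interval of length one is the Henstock--Kurzweil integral of the library, which agrees with the
  Riemann and Lebesgue integrals here because every member of the sequence is bounded and
  piecewise continuous.\<close>

fun g :: "nat \<Rightarrow> real \<Rightarrow> real" where
  "g 0 = (\<lambda>x. 0)"
| "g (Suc 0) = indicator {-1/2<..<1/2}"
| "g (Suc (Suc n)) = (\<lambda>x. g (Suc n) (x + 1/2) - g (Suc n) (x - 1/2)
      + integral {x - 1/2..x + 1/2} (g (Suc n)))"

end

theory Submission imports Defs begin

text \<open>Write \<open>g\<^sub>n\<^sub>+\<^sub>1 = (\<delta> + J) g\<^sub>n\<close> with the central difference \<open>\<delta>\<close> and the averaging operator \<open>J\<close> over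
  the unit interval around a point.  The two operators commute, so \<open>g\<^sub>n = (\<delta> + J)\<^bsup>n-1\<^esup> g\<^sub>1\<close> expands
  by the binomial theorem, and \<open>J\<^sup>m g\<^sub>1\<close> is the cardinal B-spline, an \<open>(m+1)\<close>-fold central
  difference of \<open>y\<^bsup>m-1\<^esup>\<bar>y\<bar> / (2 m!)\<close>, because \<open>y\<^sup>m\<bar>y\<bar> / (m+1)\<close> is an antiderivative of
  \<open>y\<^bsup>m-1\<^esup>\<bar>y\<bar>\<close>.\<close>

text \<open>Pascal's rule plus a shift of index: the induction step of the binomial theorem, stated
  for arbitrary coefficients. It later drives the recursion of \<open>central_diff\<close>, the
  integration of \<open>spline\<close> and the expansion of \<open>g\<close>.\<close>

lemma sum_binomial_Suc:
  fixes a :: "nat \<Rightarrow> 'a::comm_semiring_1"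
  shows "(\<Sum>j\<le>Suc n. of_nat (Suc n choose j) * a j) = (\<Sum>j\<le>n. of_nat (n choose j) * (a j + a (Suc j)))"
proof -
  have "(\<Sum>j\<le>Suc n. of_nat (Suc n choose j) * a j)
      = a 0 + (\<Sum>j\<le>n. of_nat (Suc n choose Suc j) * a (Suc j))"
    by (subst sum.atMost_Suc_shift) simp
  also have "\<dots> = (a 0 + (\<Sum>j\<le>n. of_nat (n choose Suc j) * a (Suc j)))
      + (\<Sum>j\<le>n. of_nat (n choose j) * a (Suc j))"
    by (simp add: sum.distrib algebra_simps)
  also have "a 0 + (\<Sum>j\<le>n. of_nat (n choose Suc j) * a (Suc j)) = (\<Sum>j\<le>Suc n. of_nat (n choose j) * a j)"
    by (subst sum.atMost_Suc_shift) simp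
  also have "\<dots> = (\<Sum>j\<le>n. of_nat (n choose j) * a j)"
    by (simp add: binomial_eq_0)
  finally show ?thesis
    by (simp add: sum.distrib algebra_simps)
qed

text \<open>The operator power \<open>\<delta>\<^sup>k\<close> in closed form, so that unfolding it
  yields the sums over \<open>r\<close> of the theorem.\<close>

definition central_diff :: "nat \<Rightarrow> (real \<Rightarrow> real) \<Rightarrow> real \<Rightarrow> real" where
  "central_diff k f x = (\<Sum>r\<le>k. (-1)^r * real (k choose r) * f (x + real k / 2 - real r))"

lemma central_diff_0 [simp]: "central_diff 0 f = f"
  by (simp add: central_diff_def fun_eq_iff)

lemma central_diff_Suc:
  "central_diff (Suc k) f x = central_diff k f (x + 1/2) - central_diff k f (x - 1/2)"
proof -
  have "central_diff (Suc k) f x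
      = (\<Sum>r\<le>Suc k. real (Suc k choose r) * ((-1)^r * f (x + real (Suc k) / 2 - real r)))"
    unfolding central_diff_def by (intro sum.cong) (simp_all add: mult_ac)
  also have "\<dots> = (\<Sum>r\<le>k. real (k choose r) * ((-1)^r * f (x + real (Suc k) / 2 - real r)
      + (-1)^Suc r * f (x + real (Suc k) / 2 - real (Suc r))))"
    by (rule sum_binomial_Suc)
  also have "\<dots> = central_diff k f (x + 1/2) - central_diff k f (x - 1/2)"
  proof -
    have 1: "x + real (Suc k) / 2 - real r = x + 1/2 + real k / 2 - real r"
      "x + real (Suc k) / 2 - real (Suc r) = x - 1/2 + real k / 2 - real r" for r
      by (simp_all add: field_simps)
    show ?thesis
      unfolding central_diff_def sum_subtractf[symmetric] 1
      by (intro sum.cong) (simp_all add: algebra_simps)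
  qed
  finally show ?thesis .
qed

text \<open>This is \<open>J\<^sup>m g\<^sub>1\<close>. The case \<open>m = 0\<close> is separate
  because \<open>m - 1\<close> would truncate to 0 and the sum would give a clipped ramp instead of
  the indicator.\<close>

definition spline :: "nat \<Rightarrow> real \<Rightarrow> real" where
  "spline m x = (if m = 0 then indicator {-1/2<..<1/2} x
     else (\<Sum>t\<le>Suc m. (-1)^(Suc m - t) * real (Suc m choose t) / (2 * fact m)
       * ((x - real (Suc m) / 2 + real t)^(m-1) * \<bar>x - real (Suc m) / 2 + real t\<bar>)))"

lemma spline_0: "spline 0 = indicator {-1/2<..<1/2}"
  by (simp add: spline_def fun_eq_iff)

lemma spline_Suc:
  "spline (Suc m) x = (\<Sum>t\<le>Suc (Suc m). (-1)^(Suc (Suc m) - t) * real (Suc (Suc m) choose t)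
     / (2 * fact (Suc m))
     * ((x - real (Suc (Suc m)) / 2 + real t)^m * \<bar>x - real (Suc (Suc m)) / 2 + real t\<bar>))"
  by (simp only: spline_def nat.distinct if_False diff_Suc_1)

lemma abs_has_real_derivative:
  fixes y :: real
  assumes "y \<noteq> 0"
  shows "(abs has_real_derivative sgn y) (at y)"
proof (cases "y > 0")
  case True
  have "((\<lambda>z. z) has_real_derivative sgn y) (at y)"
    using True by simp
  then show ?thesis
    by (rule has_field_derivative_transform_within_open[where S = "{0<..}"]) (use True in auto)
next
  case False
  have "(uminus has_real_derivative sgn y) (at y)"
    using False assms by (auto intro!: derivative_eq_intros)
  then show ?thesis
    by (rule has_field_derivative_transform_within_open[where S = "{..<0}"]) (use False assms in auto)
qed

text \<open>Away from 0 this is the product rule with \<open>sgn y * y = \<bar>y\<bar>\<close>; at 0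
  the difference quotient is \<open>h ^ p * \<bar>h\<bar>\<close>, which tends to 0. The exponent
  \<open>Suc p\<close> keeps out \<open>\<bar>y\<bar>\<close> itself, which has no derivative at
  0.\<close>

lemma power_times_abs_has_derivative:
  fixes y :: real
  shows "((\<lambda>y. y ^ Suc p * \<bar>y\<bar>) has_real_derivative real (Suc (Suc p)) * (y ^ p * \<bar>y\<bar>)) (at y)"
proof (cases "y = 0")
  case True
  have "((\<lambda>h::real. h ^ p * \<bar>h\<bar>) \<longlongrightarrow> 0 ^ p * \<bar>0\<bar>) (at 0)"
    by (intro tendsto_intros)
  \<comment> \<open>For \<open>p = 0\<close> the power is 1, but the factor
    \<open>\<bar>0\<bar>\<close> still makes the limit 0.\<close>
  then have "((\<lambda>h::real. h ^ p * \<bar>h\<bar>) \<longlongrightarrow> 0) (at 0)"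
    by simp
  then have "((\<lambda>h::real. (h ^ Suc p * \<bar>h\<bar>) / h) \<longlongrightarrow> 0) (at 0)"
    by (rule Lim_transform_eventually) (simp add: eventually_at_filter)
  then show ?thesis
    using True by (simp add: DERIV_def)
next
  case False
  have "((\<lambda>y. y ^ Suc p * \<bar>y\<bar>) has_real_derivative
      real (Suc p) * y ^ p * \<bar>y\<bar> + sgn y * y ^ Suc p) (at y)"
    using DERIV_mult[OF DERIV_pow[of "Suc p" y] abs_has_real_derivative[OF False]]
    by (simp only: diff_Suc_Suc diff_zero)
  moreover have "sgn y * y ^ Suc p = y ^ p * \<bar>y\<bar>"
    by (simp add: sgn_if abs_if)
  then have "real (Suc p) * y ^ p * \<bar>y\<bar> + sgn y * y ^ Suc p
      = real (Suc (Suc p)) * (y ^ p * \<bar>y\<bar>)"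
    by (simp add: algebra_simps)
  ultimately show ?thesis
    by simp
qed

text \<open>The antiderivative has kinks at -1/2 and 1/2, so the fundamental theorem is used in the
  form that allows finitely many exceptional points for a continuous primitive.\<close>

lemma spline_has_integral_0:
  "(spline 0 has_integral spline (Suc 0) x) {x - 1/2..x + 1/2}"
proof -
  \<comment> \<open>The identity clipped to values between -1/2 and 1/2.\<close>
  let ?H = "\<lambda>s::real. (\<bar>s + 1/2\<bar> - \<bar>s - 1/2\<bar>) / 2"
  have abs': "((\<lambda>s. \<bar>s + c\<bar>) has_real_derivative sgn (s + c)) (at s)" if "s + c \<noteq> 0" for s c :: real
    using abs_has_real_derivative[OF that] by (simp add: DERIV_shift)
  have "(spline 0 has_integral ?H (x + 1/2) - ?H (x - 1/2)) {x - 1/2..x + 1/2}"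
  proof (rule fundamental_theorem_of_calculus_interior_strong[where S = "{-1/2, 1/2}"])
    fix s assume "s \<in> {x - 1/2<..<x + 1/2} - {-1/2, 1/2}"
    then have s: "s + 1/2 \<noteq> 0" "s - 1/2 \<noteq> 0" by auto
    have "(?H has_real_derivative (sgn (s + 1/2) - sgn (s - 1/2)) / 2) (at s)"
      using abs'[of s "1/2"] abs'[of s "-1/2"] s
      by (intro DERIV_cdivide DERIV_diff) simp_all
    moreover have "(sgn (s + 1/2) - sgn (s - 1/2)) / 2 = spline 0 s"
      using s by (auto simp: spline_0 sgn_if indicator_def)
    ultimately show "(?H has_vector_derivative spline 0 s) (at s)"
      by (simp add: has_real_derivative_iff_has_vector_derivative)
  qed (auto intro!: continuous_intros)
  \<comment> \<open>Both sides are the tent \<open>(\<bar>x + 1\<bar> - 2 * \<bar>x\<bar> + \<bar>x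
    - 1\<bar>) / 2\<close>.\<close>
  also have "?H (x + 1/2) - ?H (x - 1/2) = spline (Suc 0) x"
    by (simp add: spline_Suc numeral_2_eq_2) (auto simp: abs_if field_simps)
  finally show ?thesis .
qed

text \<open>Each summand integrates to a difference of its primitive at two adjacent nodes, so the
  order of the difference rises by one; the divisor \<open>p + 2\<close> from the primitive
  completes the factorial.\<close>

lemma spline_has_integral_Suc:
  "(spline (Suc p) has_integral spline (Suc (Suc p)) x) {x - 1/2..x + 1/2}"
proof -
  let ?F = "\<lambda>y::real. y ^ Suc p * \<bar>y\<bar>"
  \<comment> \<open>The nodes of \<open>spline (Suc (Suc p))\<close> at \<open>x\<close>: the
    endpoints \<open>x - 1/2\<close> and \<open>x + 1/2\<close> send the node with index
    \<open>t\<close> of the lower spline to \<open>?y t\<close> and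
    \<open>?y (Suc t)\<close>.\<close>
  let ?y = "\<lambda>t. x - real (Suc (Suc (Suc p))) / 2 + real t"
  let ?c = "\<lambda>t. (-1)^(Suc (Suc p) - t) * real (Suc (Suc p) choose t) / (2 * fact (Suc p)) :: real"
  let ?d = "\<lambda>t. x - 1/2 - real (Suc (Suc p)) / 2 + real t"
  have "((\<lambda>s. \<Sum>t\<le>Suc (Suc p). ?c t *
      ((s - real (Suc (Suc p)) / 2 + real t)^p * \<bar>s - real (Suc (Suc p)) / 2 + real t\<bar>))
      has_integral (\<Sum>t\<le>Suc (Suc p). ?c t * ((?F (?y (Suc t)) - ?F (?y t)) / real (Suc (Suc p)))))
      {x - 1/2..x + 1/2}"
  proof (intro has_integral_sum has_integral_mult_right)
    fix t
    let ?e = "real t - real (Suc (Suc p)) / 2"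
    let ?G = "\<lambda>s. ?F (s + ?e) / real (Suc (Suc p))"
    have "((\<lambda>s. (s + ?e)^p * \<bar>s + ?e\<bar>) has_integral (?G (x + 1/2) - ?G (x - 1/2)))
        {x - 1/2..x + 1/2}"
    proof (rule fundamental_theorem_of_calculus)
      fix s
      have "((\<lambda>s. ?F (s + ?e)) has_real_derivative
          real (Suc (Suc p)) * ((s + ?e)^p * \<bar>s + ?e\<bar>)) (at s)"
        using power_times_abs_has_derivative[of p "s + ?e"] unfolding DERIV_shift .
      then have "(?G has_real_derivative
          real (Suc (Suc p)) * ((s + ?e)^p * \<bar>s + ?e\<bar>) / real (Suc (Suc p))) (at s)"
        by (rule DERIV_cdivide)
      then have "(?G has_real_derivative (s + ?e)^p * \<bar>s + ?e\<bar>) (at s)"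
        by (simp del: of_nat_Suc)
      then show "(?G has_vector_derivative (s + ?e)^p * \<bar>s + ?e\<bar>) (at s within {x - 1/2..x + 1/2})"
        unfolding has_real_derivative_iff_has_vector_derivative
        by (rule has_vector_derivative_at_within)
    qed simp
    moreover have "s + ?e = s - real (Suc (Suc p)) / 2 + real t" for s by simp
    moreover have "x + 1/2 - real (Suc (Suc p)) / 2 + real t = ?y (Suc t)"
      "x - 1/2 - real (Suc (Suc p)) / 2 + real t = ?y t"
      by (simp_all add: field_simps)
    ultimately show "((\<lambda>s. (s - real (Suc (Suc p)) / 2 + real t)^p
        * \<bar>s - real (Suc (Suc p)) / 2 + real t\<bar>)
        has_integral (?F (?y (Suc t)) - ?F (?y t)) / real (Suc (Suc p))) {x - 1/2..x + 1/2}"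
      by (simp only: diff_divide_distrib)
  qed simp
  also have "(\<lambda>s. \<Sum>t\<le>Suc (Suc p). ?c t *
      ((s - real (Suc (Suc p)) / 2 + real t)^p * \<bar>s - real (Suc (Suc p)) / 2 + real t\<bar>))
      = spline (Suc p)"
    by (simp only: spline_Suc fun_eq_iff) simp
  also have "(\<Sum>t\<le>Suc (Suc p). ?c t * ((?F (?y (Suc t)) - ?F (?y t)) / real (Suc (Suc p))))
      = (\<Sum>t\<le>Suc (Suc p). real (Suc (Suc p) choose t) *
          ((-1)^(Suc (Suc (Suc p)) - t) * ?F (?y t) / (2 * fact (Suc (Suc p)))
          + (-1)^(Suc (Suc (Suc p)) - Suc t) * ?F (?y (Suc t)) / (2 * fact (Suc (Suc p)))))"
  proof (rule sum.cong)
    fix t assume "t \<in> {..Suc (Suc p)}"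
    then have t: "Suc (Suc (Suc p)) - t = Suc (Suc (Suc p) - t)"
      by (simp add: Suc_diff_le)
    \<comment> \<open>Here \<open>C\<close> is the sign, \<open>B\<close> the binomial coefficient,
      \<open>W\<close> the factorial of \<open>p + 1\<close> and \<open>N\<close> is
      \<open>p + 2\<close>. The minus sign of the lower endpoint raises the exponent of -1 by one,
      and \<open>N * W\<close> is the next factorial.\<close>
    have C: "C * B / (2 * W) * ((u - v) / N)
        = B * (- C * v / (2 * (N * W)) + C * u / (2 * (N * W)))" for B C N W u v :: real
      by (simp add: algebra_simps add_divide_distrib diff_divide_distrib)
    show "?c t * ((?F (?y (Suc t)) - ?F (?y t)) / real (Suc (Suc p)))
        = real (Suc (Suc p) choose t) *
          ((-1)^(Suc (Suc (Suc p)) - t) * ?F (?y t) / (2 * fact (Suc (Suc p)))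
          + (-1)^(Suc (Suc (Suc p)) - Suc t) * ?F (?y (Suc t)) / (2 * fact (Suc (Suc p))))"
      unfolding t diff_Suc_Suc C fact_Suc[of "Suc p"] by simp
  qed simp
  also have "\<dots> = (\<Sum>t\<le>Suc (Suc (Suc p)). real (Suc (Suc (Suc p)) choose t) *
          ((-1)^(Suc (Suc (Suc p)) - t) * ?F (?y t) / (2 * fact (Suc (Suc p)))))"
    by (rule sum_binomial_Suc[symmetric])
  also have "\<dots> = spline (Suc (Suc p)) x"
    unfolding spline_Suc by (simp only: mult_ac times_divide_eq_left times_divide_eq_right)
  finally show ?thesis .
qed

lemma spline_has_integral:
  "(spline m has_integral spline (Suc m) x) {x - 1/2..x + 1/2}"
  using spline_has_integral_0 spline_has_integral_Suc by (cases m) auto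

text \<open>The commutation of \<open>J\<close> with \<open>\<delta>\<^sup>k\<close>: a central
  difference is a linear combination of translates, and integration respects both.\<close>

lemma central_diff_has_integral:
  assumes "\<And>x. (f has_integral h x) {x - 1/2..x + 1/2}"
  shows "(central_diff k f has_integral central_diff k h x) {x - 1/2..x + 1/2}"
  unfolding central_diff_def[abs_def]
proof (intro has_integral_sum has_integral_mult_right)
  fix r
  show "((\<lambda>s. f (s + real k / 2 - real r)) has_integral h (x + real k / 2 - real r))
      {x - 1/2..x + 1/2}"
    using has_integral_shift_real_ivl[OF assms[of "x + (real k / 2 - real r)"],
        of "real k / 2 - real r"]
    by (simp add: algebra_simps)
qed simp

text \<open>The binomial expansion of \<open>(\<delta> + J)\<^sup>n g\<^sub>1\<close>, by induction:
  \<open>\<delta>\<close> raises the order of the difference and \<open>J\<close> the index of the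
  spline.\<close>

lemma g_Suc_eq:
  "g (Suc n) x = (\<Sum>k\<le>n. real (n choose k) * central_diff k (spline (n - k)) x)"
proof (induction n arbitrary: x)
  case 0
  then show ?case by (simp add: spline_0)
next
  case (Suc n)
  have eq: "g (Suc n) = (\<lambda>x. \<Sum>k\<le>n. real (n choose k) * central_diff k (spline (n - k)) x)"
    using Suc.IH by blast
  have "(g (Suc n) has_integral
      (\<Sum>k\<le>n. real (n choose k) * central_diff k (spline (Suc (n - k))) x)) {x - 1/2..x + 1/2}"
    unfolding eq
    by (intro has_integral_sum has_integral_mult_right central_diff_has_integral spline_has_integral) simp
  then have int: "integral {x - 1/2..x + 1/2} (g (Suc n))
      = (\<Sum>k\<le>n. real (n choose k) * central_diff k (spline (Suc (n - k))) x)"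
    by (rule integral_unique)
  \<comment> \<open>Writing the spline index of the difference term as \<open>Suc n - Suc k\<close>
    makes the two terms consecutive members of one sequence, as \<open>sum_binomial_Suc\<close>
    requires.\<close>
  have "g (Suc (Suc n)) x = (\<Sum>k\<le>n. real (n choose k) *
      (central_diff k (spline (Suc n - k)) x + central_diff (Suc k) (spline (Suc n - Suc k)) x))"
    unfolding g.simps int Suc.IH central_diff_Suc sum_subtractf[symmetric] sum.distrib[symmetric]
    by (intro sum.cong) (simp_all add: algebra_simps Suc_diff_le)
  also have "\<dots> = (\<Sum>k\<le>Suc n. real (Suc n choose k) * central_diff k (spline (Suc n - k)) x)"
    by (rule sum_binomial_Suc[symmetric])
  finally show ?case .
qed

theorem theorem2p4:
  fixes n :: nat and x :: real
  assumes "n \<ge> 2"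
  shows "g n x =
    (\<Sum>k=0..n-2. \<Sum>r=0..k. \<Sum>t=0..n-k.
       (-1)^r * real ((n-1) choose k) * real (k choose r) * (real (n-k) / 2)
       * ((-1)^(n-k-t) / (fact t * fact (n-k-t)))
       * (x + real k - real r - real n / 2 + real t)^(n-k-2)
       * \<bar>x + real k - real r - real n / 2 + real t\<bar>)
    + (\<Sum>r=0..n-1. (-1)^r * real ((n-1) choose r)
       * g 1 (x + (real n - 1) / 2 - real r))"
proof -
  obtain N where n: "n = Suc (Suc N)"
    using assms by (metis add_2_eq_Suc le_Suc_ex)
  \<comment> \<open>The top term \<open>k = n - 1\<close> is split off: it alone involves
    \<open>spline 0\<close>, and it becomes the second sum of the theorem.\<close>
  have "g n x = (\<Sum>k\<le>N. real (Suc N choose k) * central_diff k (spline (Suc N - k)) x)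
      + central_diff (Suc N) (spline 0) x"
    unfolding n g_Suc_eq by simp
  also have "central_diff (Suc N) (spline 0) x = (\<Sum>r=0..n-1. (-1)^r * real ((n-1) choose r)
       * g 1 (x + (real n - 1) / 2 - real r))"
    unfolding central_diff_def n by (simp add: atLeast0AtMost spline_0)
  also have "(\<Sum>k\<le>N. real (Suc N choose k) * central_diff k (spline (Suc N - k)) x)
      = (\<Sum>k=0..n-2. \<Sum>r=0..k. \<Sum>t=0..n-k.
       (-1)^r * real ((n-1) choose k) * real (k choose r) * (real (n-k) / 2)
       * ((-1)^(n-k-t) / (fact t * fact (n-k-t)))
       * (x + real k - real r - real n / 2 + real t)^(n-k-2)
       * \<bar>x + real k - real r - real n / 2 + real t\<bar>)"
    unfolding atLeast0AtMost
  proof (rule sum.cong)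
    show "{..N} = {..n - 2}" by (simp add: n)
    fix k assume "k \<in> {..n - 2}"
    then have k: "k \<le> N" by (simp add: n)
    then obtain p where p: "N = k + p" using le_Suc_ex by blast
    have m: "Suc N - k = Suc p" "n - k = Suc (Suc p)" "n - 1 = Suc N" "Suc (Suc p) - 2 = p"
      by (simp_all add: p n)
    have y: "x + real k / 2 - real r - real (Suc (Suc p)) / 2 + real t
        = x + real k - real r - real n / 2 + real t" for r t
      by (simp add: n p field_simps)
    \<comment> \<open>With \<open>n - k = p + 2\<close>, cancelling the factorial of
      \<open>p + 1\<close> leaves the factor \<open>(n - k) / 2\<close> of the theorem.\<close>
    have c: "real (Suc (Suc p) choose t) / (2 * fact (Suc p))
        = real (Suc (Suc p)) / 2 / (fact t * fact (Suc (Suc p) - t))" if "t \<le> Suc (Suc p)" for t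
      unfolding binomial_fact[OF that] fact_Suc[of "Suc p"] by (simp add: divide_simps)
    \<comment> \<open>Pure reordering of a summand, with \<open>c\<close> supplying the
      premise.\<close>
    have e: "b * (e1 * b2 * (e2 * B / W * (P * A))) = e1 * b * b2 * H * (e2 / V) * P * A"
      if "B / W = H / V" for b e1 b2 e2 B W P A H V :: real
    proof -
      have "b * (e1 * b2 * (e2 * B / W * (P * A))) = b * e1 * b2 * e2 * P * A * (B / W)"
        by simp
      then show ?thesis
        unfolding that by simp
    qed
    show "real (Suc N choose k) * central_diff k (spline (Suc N - k)) x
      = (\<Sum>r\<le>k. \<Sum>t\<le>n - k.
       (-1)^r * real ((n-1) choose k) * real (k choose r) * (real (n-k) / 2)
       * ((-1)^(n-k-t) / (fact t * fact (n-k-t)))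
       * (x + real k - real r - real n / 2 + real t)^(n-k-2)
       * \<bar>x + real k - real r - real n / 2 + real t\<bar>)"
      unfolding central_diff_def m spline_Suc y sum_distrib_left
      by (intro sum.cong refl e c) simp
  qed
  finally show ?thesis .
qed

end
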